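(* Let $\preceq$ be the total preorder on $\Omega$ induced by a surjective map $Z:\Omega\to[0,1]$, and let $\underline{E}$ be the natural extension of a p-box $(\underline{F},\overline{F})$ on $(\Omega,\preceq)$, with conjugate $\overline{E}$. For any gamble $f$ on $\Omega$, $$\underline{E}(f)=\inf\underline{\mathrm{osc}}(f)+\int_{\inf\underline{\mathrm{osc}}(f)}^{\sup\underline{\mathrm{osc}}(f)}\underline{E}\bigl(\{z:\underline{\mathrm{osc}}(f)(z)\ge t\}\bigr)\,\mathrm{d}t,$$ $$\overline{E}(f)=\inf\overline{\mathrm{osc}}(f)+\int_{\inf\overline{\mathrm{osc}}(f)}^{\sup\overline{\mathrm{osc}}(f)}\overline{E}\bigl(\{z:\overline{\mathrm{osc}}(f)(z)\ge t\}\bigr)\,\mathrm{d}t.$$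
   Context: $Z:\Omega\to[0,1]$ is surjective and $x\preceq y$ is defined to mean $Z(x)\le Z(y)$; this is a total preorder. Choose $0_\Omega,1_\Omega$ with $Z(0_\Omega)=0$, $Z(1_\Omega)=1$. Write $x\prec y$ if $Z(x)<Z(y)$; $[x,y]=\{v:x\preceq v\preceq y\}$, $(x,y]=\{v:x\prec v\preceq y\}$, etc.; $x\simeq y$ means $Z(x)=Z(y)$ and $[x]_\simeq$ is the equivalence class of $x$. A gamble is a bounded function $\Omega\to\mathbb{R}$; an event is identified with its indicator. A lower prevision on all gambles is coherent if $\underline{P}(f)\ge\inf f$, $\underline{P}(\lambda f)=\lambda\underline{P}(f)$, $\underline{P}(f+g)\ge\underline{P}(f)+\underline{P}(g)$ for all gambles $f,g$ and $\lambda\ge0$. A linear prevision is a functional $Q$ on all gambles with $Q(f)\ge\inf f$ and $Q(f+g)=Q(f)+Q(g)$. A cumulative distribution function is a map $F:\Omega\to[0,1]$, non-decreasing with respect to $\preceq$, with $F(1_\Omega)=1$. A p-box is a pair $(\underline{F},\overline{F})$ of cumulative distribution functions with $\underline{F}\le\overline{F}$. Its natural extension $\underline{E}$ is the pointwise smallest coherent lower prevision on all gambles with $\underline{E}([0_\Omega,x])=\underline{F}(x)$ and $\underline{E}((y,1_\Omega])=1-\overline{F}(y)$ for all $x,y\in\Omega$; equivalently $\underline{E}(f)=\min Q(f)$ over all linear previsions $Q$ with $\underline{F}(x)\le Q([0_\Omega,x])\le\overline{F}(x)$ for all $x\in\Omega$. The conjugate is $\overline{E}(f)=-\underline{E}(-f)$.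 For $I\subseteq[0,1]$, write $\underline{E}(I)=\underline{E}(Z^{-1}(I))$ and $\overline{E}(I)=\overline{E}(Z^{-1}(I))$. The lower and upper oscillations of a gamble $f$ are $\underline{\mathrm{osc}}(f)(x)=\inf_{y\in[x]_\simeq}f(y)$ and $\overline{\mathrm{osc}}(f)(x)=\sup_{y\in[x]_\simeq}f(y)$. They are constant on equivalence classes and are regarded as functions of $z=Z(x)\in[0,1]$: $\underline{\mathrm{osc}}(f)(z)=\inf_{Z(y)=z}f(y)$, $\overline{\mathrm{osc}}(f)(z)=\sup_{Z(y)=z}f(y)$. Integrals are Riemann integrals of monotone functions. *)

theory Defs
  imports "HOL-Analysis.Analysis"
begin

text \<open>
  The possibility space is the type \<^typ>\<open>'a\<close>. A real-valued map \<open>Z\<close> on it with range \<open>[0,1]\<close> induces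
  the total preorder \<open>x \<preceq> y \<longleftrightarrow> Z x \<le> Z y\<close>.
\<close>

definition cc_interval :: "('a \<Rightarrow> real) \<Rightarrow> 'a \<Rightarrow> 'a \<Rightarrow> 'a set"
  where "cc_interval Z x y = {v. Z x \<le> Z v \<and> Z v \<le> Z y}"

definition oc_interval :: "('a \<Rightarrow> real) \<Rightarrow> 'a \<Rightarrow> 'a \<Rightarrow> 'a set"
  where "oc_interval Z x y = {v. Z x < Z v \<and> Z v \<le> Z y}"

definition gamble :: "('a \<Rightarrow> real) \<Rightarrow> bool"
  where "gamble f \<longleftrightarrow> bounded (range f)"

text \<open>
  Functionals on gambles are represented by total functionals on all real functions; nothing is
  required of their values on unbounded functions.
\<close>

definition coherent_lower_prevision :: "(('a \<Rightarrow> real) \<Rightarrow> real) \<Rightarrow> bool"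
  where "coherent_lower_prevision P \<longleftrightarrow>
    (\<forall>f. gamble f \<longrightarrow> (INF x. f x) \<le> P f) \<and>
    (\<forall>f c. gamble f \<longrightarrow> 0 \<le> c \<longrightarrow> P (\<lambda>x. c * f x) = c * P f) \<and>
    (\<forall>f g. gamble f \<longrightarrow> gamble g \<longrightarrow> P f + P g \<le> P (\<lambda>x. f x + g x))"

definition conjugate :: "(('a \<Rightarrow> real) \<Rightarrow> real) \<Rightarrow> ('a \<Rightarrow> real) \<Rightarrow> real"
  where "conjugate P f = - P (\<lambda>x. - f x)"

definition cdf_on :: "('a \<Rightarrow> real) \<Rightarrow> 'a \<Rightarrow> ('a \<Rightarrow> real) \<Rightarrow> bool"
  where "cdf_on Z one F \<longleftrightarrow>
    (\<forall>x. 0 \<le> F x \<and> F x \<le> 1) \<and> (\<forall>x y. Z x \<le> Z y \<longrightarrow> F x \<le> F y) \<and> F one = 1"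

definition p_box :: "('a \<Rightarrow> real) \<Rightarrow> 'a \<Rightarrow> ('a \<Rightarrow> real) \<Rightarrow> ('a \<Rightarrow> real) \<Rightarrow> bool"
  where "p_box Z one Fl Fu \<longleftrightarrow> cdf_on Z one Fl \<and> cdf_on Z one Fu \<and> (\<forall>x. Fl x \<le> Fu x)"

definition extends_p_box ::
    "('a \<Rightarrow> real) \<Rightarrow> 'a \<Rightarrow> 'a \<Rightarrow> ('a \<Rightarrow> real) \<Rightarrow> ('a \<Rightarrow> real) \<Rightarrow> (('a \<Rightarrow> real) \<Rightarrow> real) \<Rightarrow> bool"
  where "extends_p_box Z zero one Fl Fu P \<longleftrightarrow>
    coherent_lower_prevision P \<and>
    (\<forall>x. P (indicator (cc_interval Z zero x)) = Fl x) \<and>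
    (\<forall>y. P (indicator (oc_interval Z y one)) = 1 - Fu y)"

definition is_natural_extension ::
    "('a \<Rightarrow> real) \<Rightarrow> 'a \<Rightarrow> 'a \<Rightarrow> ('a \<Rightarrow> real) \<Rightarrow> ('a \<Rightarrow> real) \<Rightarrow> (('a \<Rightarrow> real) \<Rightarrow> real) \<Rightarrow> bool"
  where "is_natural_extension Z zero one Fl Fu E \<longleftrightarrow>
    extends_p_box Z zero one Fl Fu E \<and>
    (\<forall>P f. extends_p_box Z zero one Fl Fu P \<longrightarrow> gamble f \<longrightarrow> E f \<le> P f)"

lemma is_natural_extension_unique:
  assumes "is_natural_extension Z zero one Fl Fu E" "is_natural_extension Z zero one Fl Fu E'"
    and "gamble f"
  shows "E f = E' f"
  using assms unfolding is_natural_extension_def by (meson order_antisym)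

text \<open>
  The choice operator only fixes the irrelevant values outside the gambles: on gambles
  the smallest extension is unique.
\<close>

definition natural_extension ::
    "('a \<Rightarrow> real) \<Rightarrow> 'a \<Rightarrow> 'a \<Rightarrow> ('a \<Rightarrow> real) \<Rightarrow> ('a \<Rightarrow> real) \<Rightarrow> ('a \<Rightarrow> real) \<Rightarrow> real"
  where "natural_extension Z zero one Fl Fu = (SOME E. is_natural_extension Z zero one Fl Fu E)"

text \<open>A functional evaluated at a set \<open>I\<close> of values of \<open>Z\<close>, that is, at the event \<open>Z \<in> I\<close>.\<close>

definition on_values :: "(('a \<Rightarrow> real) \<Rightarrow> real) \<Rightarrow> ('a \<Rightarrow> real) \<Rightarrow> real set \<Rightarrow> real"
  where "on_values P Z I = P (indicator (Z -` I))"

text \<open>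
  The oscillations, as functions of the common value \<open>z \<in> [0,1]\<close> of \<open>Z\<close> on an equivalence class.
  Outside \<open>[0,1]\<close> the class is empty and the value is meaningless.
\<close>

definition lower_osc :: "('a \<Rightarrow> real) \<Rightarrow> ('a \<Rightarrow> real) \<Rightarrow> real \<Rightarrow> real"
  where "lower_osc Z f z = (INF y\<in>{y. Z y = z}. f y)"

definition upper_osc :: "('a \<Rightarrow> real) \<Rightarrow> ('a \<Rightarrow> real) \<Rightarrow> real \<Rightarrow> real"
  where "upper_osc Z f z = (SUP y\<in>{y. Z y = z}. f y)"

end

theory Submission
  imports Defs
begin

text \<open>
  The natural extension is the expectation of the infimum over a random interval. Draw \<open>u\<close> uniformly
  from \<open>(0,1)\<close>. The levels \<open>a\<close> at which the upper cdf is below \<open>u\<close> lie below the levels \<open>b\<close> at which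
  the lower cdf is above \<open>u\<close>, and the sets \<open>{v. a < Z v \<le> b}\<close> for such pairs are nonempty and closed
  under finite intersection. So they generate a proper filter, and the lower limit of a gamble
  along it, called its core at \<open>u\<close>, is a coherent lower prevision for each \<open>u\<close>. As cdfs of p-boxes
  need not be continuous from either side, an infimum over one limiting interval would not do.

  Integrating the core over \<open>u\<close> gives a functional \<open>C\<close> with four properties.

  \<^item> \<open>C\<close> is a coherent lower prevision, since it is an average of such, and it has the values
    prescribed by the p-box (\<open>core_prevision_coherent\<close>, \<open>core_prevision_down_set\<close>,
    \<open>core_prevision_up_set\<close>).

  \<^item> \<open>C\<close> lies below every other coherent extension on events (\<open>core_prevision_event_le\<close>): the set of
    those \<open>u\<close> whose interval fits into the event is open, hence up to \<open>\<epsilon>\<close> covered by finitely many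
    intervals, which can be merged until the corresponding slabs are disjoint.

  \<^item> Every coherent lower prevision dominates the Choquet integral of its restriction to events
    (\<open>ge_choquet\<close>), and \<open>C\<close> equals that integral (\<open>core_prevision_choquet\<close>), because the core of a
    gamble and the cores of its level sets are linked pointwise in \<open>u\<close>. With the previous item this
    makes \<open>C\<close> the smallest extension (\<open>core_prevision_le\<close>), i.e. the natural extension.

  \<^item> All slabs are unions of equivalence classes, so \<open>C\<close> does not distinguish a gamble from its lower
    oscillation (\<open>core_prevision_class_inf\<close>).

  The first formula is the Choquet integral of the lower oscillation. The second one follows by
  applying \<open>C\<close> to \<open>- f\<close>, whose lower oscillation is minus the upper oscillation of \<open>f\<close>, and substituting
  \<open>t \<mapsto> - t\<close> in the integral.
\<close>

section \<open>Layer sums of bounded functions\<close>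

text \<open>
  A family \<open>A\<close> of upper level sets of \<open>h\<close>. Any choice between the strict and the weak level sets
  is allowed: conjugation turns weak level sets of \<open>h\<close> into complements of strict ones of \<open>- h\<close>,
  so both kinds occur.
\<close>

definition level_family :: "('a \<Rightarrow> real) \<Rightarrow> (real \<Rightarrow> 'a set) \<Rightarrow> bool"
  where "level_family h A \<longleftrightarrow> (\<forall>t. {x. t < h x} \<subseteq> A t \<and> A t \<subseteq> {x. t \<le> h x})"

lemma level_family_antimono:
  assumes "level_family h A" "s \<le> t"
  shows "A t \<subseteq> A s"
proof (cases "s = t")
  case False
  then have "A t \<subseteq> {x. s < h x}"
    using assms unfolding level_family_def by fastforce
  then show ?thesis
    using assms unfolding level_family_def by blast
qed simp

text \<open>
  The number of levels \<open>m + i * \<delta>\<close> that \<open>y\<close> reaches, times the step \<open>\<delta>\<close>, recovers \<open>y - m\<close> up to one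
  step. This bound and the next are the two halves; reaching may be strict or not, and each half is
  stated in its stronger form.
\<close>

lemma layer_count_le:
  fixes m \<delta> y :: real
  assumes "0 \<le> \<delta>" "m \<le> y"
  shows "\<delta> * (\<Sum>i=1..n. of_bool (m + real i * \<delta> \<le> y)) \<le> y - m"
proof (induction n)
  case 0
  then show ?case using assms by simp
next
  case (Suc n)
  show ?case
  proof (cases "m + real (Suc n) * \<delta> \<le> y")
    case True
    have "(\<Sum>i=1..Suc n. of_bool (m + real i * \<delta> \<le> y)) \<le> (\<Sum>i=1..Suc n. (1::real))"
      by (intro sum_mono) auto
    then have "\<delta> * (\<Sum>i=1..Suc n. of_bool (m + real i * \<delta> \<le> y)) \<le> \<delta> * real (Suc n)"
      using assms by (intro mult_left_mono) auto
    with True show ?thesis by (simp only: mult.commute[of \<delta>])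
  next
    case False
    with Suc show ?thesis by simp
  qed
qed

lemma layer_count_ge:
  fixes m \<delta> y :: real
  assumes "y \<le> m + real (Suc n) * \<delta>" "0 \<le> \<delta>"
  shows "y \<le> m + \<delta> + \<delta> * (\<Sum>i=1..n. of_bool (m + real i * \<delta> < y))"
  using assms(1)
proof (induction n)
  case 0
  then show ?case by simp
next
  case (Suc n)
  show ?case
  proof (cases "m + real (Suc n) * \<delta> < y")
    case True
    have "of_bool (m + real i * \<delta> < y) = (1::real)" if "i \<in> {1..Suc n}" for i
    proof -
      have "real i * \<delta> \<le> real (Suc n) * \<delta>"
        using that assms(2) by (intro mult_right_mono) auto
      with True show ?thesis by simp
    qed
    then have "(\<Sum>i=1..Suc n. of_bool (m + real i * \<delta> < y)) = (\<Sum>i=1..Suc n. (1::real))"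
      by (intro sum.cong) auto
    with Suc.prems show ?thesis by (simp add: algebra_simps)
  next
    case False
    then show ?thesis using Suc.IH by simp
  qed
qed

lemma antimono_integrable_on:
  fixes \<phi> :: "real \<Rightarrow> real"
  assumes "antimono \<phi>"
  shows "\<phi> integrable_on {a..b}"
proof -
  have "mono (\<lambda>t. - \<phi> t)"
    using assms by (auto simp: monotone_def)
  then have "(\<lambda>t. - \<phi> t) \<in> borel_measurable borel"
    by (rule borel_measurable_mono)
  then have "\<phi> \<in> borel_measurable borel"
    using borel_measurable_uminus_eq by blast
  then have "\<phi> \<in> borel_measurable (lebesgue_on {a..b})"
    by (simp add: borel_measurable_if_D measurable_completion measurable_restrict_space1)
  then show ?thesis
  proof (rule measurable_bounded_by_integrable_imp_integrable)
    show "(\<lambda>t. max \<bar>\<phi> a\<bar> \<bar>\<phi> b\<bar>) integrable_on {a..b}"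
      by (simp add: integrable_const_ivl)
    show "norm (\<phi> t) \<le> max \<bar>\<phi> a\<bar> \<bar>\<phi> b\<bar>" if "t \<in> {a..b}" for t
      using that antimonoD[OF assms, of a t] antimonoD[OF assms, of t b] by auto
  qed auto
qed

text \<open>
  Riemann sums with right end points bound the integral of a decreasing function from below; the error
  telescopes to \<open>\<delta>\<close> times the total drop.
\<close>

lemma antimono_integral_bounds:
  fixes \<phi> :: "real \<Rightarrow> real"
  assumes "antimono \<phi>" "0 \<le> \<delta>"
  shows "\<delta> * (\<Sum>i=1..n. \<phi> (m + real i * \<delta>)) \<le> integral {m..m + real n * \<delta>} \<phi>"
    and "integral {m..m + real n * \<delta>} \<phi>
      \<le> \<delta> * (\<phi> m - \<phi> (m + real n * \<delta>)) + \<delta> * (\<Sum>i=1..n. \<phi> (m + real i * \<delta>))"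
proof -
  have piece: "\<delta> * \<phi> (c + \<delta>) \<le> integral {c..c + \<delta>} \<phi> \<and> integral {c..c + \<delta>} \<phi> \<le> \<delta> * \<phi> c" for c
  proof
    have "integral {c..c + \<delta>} (\<lambda>t. \<phi> (c + \<delta>)) \<le> integral {c..c + \<delta>} \<phi>"
      using assms by (intro integral_le antimono_integrable_on integrable_const_ivl) (auto intro: antimonoD)
    then show "\<delta> * \<phi> (c + \<delta>) \<le> integral {c..c + \<delta>} \<phi>"
      using assms by simp
    have "integral {c..c + \<delta>} \<phi> \<le> integral {c..c + \<delta>} (\<lambda>t. \<phi> c)"
      using assms by (intro integral_le antimono_integrable_on integrable_const_ivl) (auto intro: antimonoD)
    then show "integral {c..c + \<delta>} \<phi> \<le> \<delta> * \<phi> c"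
      using assms by simp
  qed
  have split: "integral {m..m + real (Suc n) * \<delta>} \<phi>
      = integral {m..m + real n * \<delta>} \<phi> + integral {m + real n * \<delta>..(m + real n * \<delta>) + \<delta>} \<phi>" for n
  proof -
    have "integral {m..m + real n * \<delta>} \<phi> + integral {m + real n * \<delta>..(m + real n * \<delta>) + \<delta>} \<phi>
        = integral {m..(m + real n * \<delta>) + \<delta>} \<phi>"
      using assms by (intro Henstock_Kurzweil_Integration.integral_combine antimono_integrable_on) auto
    then show ?thesis
      by (simp add: algebra_simps)
  qed
  have step: "(m + real n * \<delta>) + \<delta> = m + real (Suc n) * \<delta>" for n
    by (simp add: algebra_simps)
  show "\<delta> * (\<Sum>i=1..n. \<phi> (m + real i * \<delta>)) \<le> integral {m..m + real n * \<delta>} \<phi>"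
  proof (induction n)
    case (Suc n)
    then show ?case
      unfolding split using piece[of "m + real n * \<delta>"] unfolding step
      by (simp add: distrib_left)
  qed simp
  show "integral {m..m + real n * \<delta>} \<phi>
      \<le> \<delta> * (\<phi> m - \<phi> (m + real n * \<delta>)) + \<delta> * (\<Sum>i=1..n. \<phi> (m + real i * \<delta>))"
  proof (induction n)
    case (Suc n)
    then show ?case
      unfolding split using piece[of "m + real n * \<delta>"] unfolding step
      by (simp add: distrib_left right_diff_distrib)
  qed simp
qed

lemma le_if_le_add_divide_nat:
  fixes x y c :: real
  assumes "\<And>n. n \<ge> 1 \<Longrightarrow> x \<le> y + c / real n"
  shows "x \<le> y"
proof (rule LIMSEQ_le_const)
  show "(\<lambda>n. y + c / real n) \<longlonglongrightarrow> y"
    using tendsto_add[OF tendsto_const[of y] lim_const_over_n[of c]] by simp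
  show "\<exists>N. \<forall>n\<ge>N. x \<le> y + c / real n"
    using assms by blast
qed

section \<open>Coherent lower previsions\<close>

lemma gamble_iff: "gamble f \<longleftrightarrow> (\<exists>B. \<forall>x. \<bar>f x\<bar> \<le> B)"
  by (auto simp: gamble_def bounded_iff)

lemma gambleI: "(\<And>x. a \<le> f x) \<Longrightarrow> (\<And>x. f x \<le> b) \<Longrightarrow> gamble f"
  unfolding gamble_iff by (rule exI[of _ "max \<bar>a\<bar> \<bar>b\<bar>"]) 
    (metis abs_le_iff abs_ge_self abs_ge_minus_self le_max_iff_disj neg_le_iff_le order_trans)

lemma gamble_bdd:
  assumes "gamble f"
  shows "bdd_below (f ` S)" "bdd_above (f ` S)"
proof -
  obtain B where B: "\<bar>f x\<bar> \<le> B" for x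
    using assms unfolding gamble_iff by blast
  show "bdd_below (f ` S)"
    by (rule bdd_belowI2[of _ "- B"]) (use B in \<open>simp add: abs_le_iff minus_le_iff\<close>)
  show "bdd_above (f ` S)"
    by (rule bdd_aboveI2[of _ _ B]) (use B in \<open>simp add: abs_le_iff\<close>)
qed

lemma gamble_const: "gamble (\<lambda>x. c)"
  by (auto simp: gamble_iff)

lemma gamble_indicator: "gamble (indicator A)"
  by (rule gambleI[of 0 _ 1]) (auto simp: indicator_def)

lemma gamble_add: "gamble f \<Longrightarrow> gamble g \<Longrightarrow> gamble (\<lambda>x. f x + g x)"
  unfolding gamble_def by (rule bounded_plus_comp)

lemma gamble_cmult: "gamble f \<Longrightarrow> gamble (\<lambda>x. c * f x)"
  unfolding gamble_def using bounded_scaling[of "range f" c] by (simp add: image_image)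

lemma gamble_uminus: "gamble f \<Longrightarrow> gamble (\<lambda>x. - f x)"
  using gamble_cmult[of f "-1"] by simp

lemma gamble_sum: "finite I \<Longrightarrow> (\<And>i. i \<in> I \<Longrightarrow> gamble (g i)) \<Longrightarrow> gamble (\<lambda>x. \<Sum>i\<in>I. g i x)"
  by (induction I rule: finite_induct) (auto intro: gamble_add gamble_const)

lemma lower_osc_le:
  assumes "gamble f"
  shows "lower_osc Z f (Z v) \<le> f v"
  unfolding lower_osc_def by (rule cINF_lower[OF gamble_bdd(1)[OF assms]]) simp

lemma gamble_lower_osc:
  assumes "gamble f"
  shows "gamble (\<lambda>v. lower_osc Z f (Z v))"
proof -
  obtain B where "\<bar>f x\<bar> \<le> B" for x
    using assms unfolding gamble_iff by blast
  then have B: "- B \<le> f x" "f x \<le> B" for x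
    by (simp_all add: abs_le_iff minus_le_iff)
  show ?thesis
  proof (rule gambleI)
    show "- B \<le> lower_osc Z f (Z v)" for v
      unfolding lower_osc_def using B(1) by (intro cINF_greatest) auto
    show "lower_osc Z f (Z v) \<le> B" for v
      using lower_osc_le[OF assms] B(2) by (rule order_trans)
  qed
qed

lemma lower_osc_uminus: "lower_osc Z (\<lambda>x. - f x) z = - upper_osc Z f z"
  by (simp add: lower_osc_def upper_osc_def Inf_real_def image_image)

locale coherent =
  fixes P :: "('a \<Rightarrow> real) \<Rightarrow> real"
  assumes coherent: "coherent_lower_prevision P"
begin

lemma ge_bound:
  assumes "gamble f" "\<And>x. c \<le> f x"
  shows "c \<le> P f"
proof -
  have "c \<le> (INF x. f x)"
    using assms(2) by (intro cINF_greatest) auto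
  also have "\<dots> \<le> P f"
    using coherent assms(1) by (simp add: coherent_lower_prevision_def)
  finally show ?thesis .
qed

lemma scale: "gamble f \<Longrightarrow> 0 \<le> c \<Longrightarrow> P (\<lambda>x. c * f x) = c * P f"
  using coherent by (simp add: coherent_lower_prevision_def)

lemma superadd: "gamble f \<Longrightarrow> gamble g \<Longrightarrow> P f + P g \<le> P (\<lambda>x. f x + g x)"
  using coherent by (simp add: coherent_lower_prevision_def)

lemma zero: "P (\<lambda>x. 0) = 0"
  using scale[OF gamble_const, of 0] by simp

lemma mono:
  assumes "gamble f" "gamble g" "\<And>x. f x \<le> g x"
  shows "P f \<le> P g"
proof -
  have d: "gamble (\<lambda>x. g x + - f x)"
    using assms by (intro gamble_add gamble_uminus)
  have "0 \<le> P (\<lambda>x. g x + - f x)"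
    by (rule ge_bound[OF d]) (simp add: assms)
  moreover have "P f + P (\<lambda>x. g x + - f x) \<le> P g"
    using superadd[OF assms(1) d] by simp
  ultimately show ?thesis by simp
qed

lemma add_const:
  assumes "gamble f"
  shows "P (\<lambda>x. f x + c) = P f + c"
proof (rule antisym)
  have *: "P g + d \<le> P (\<lambda>x. g x + d)" if "gamble g" for g d
    using superadd[OF that gamble_const, of d] ge_bound[OF gamble_const, of d d] by simp
  show "P f + c \<le> P (\<lambda>x. f x + c)"
    by (rule *[OF assms])
  show "P (\<lambda>x. f x + c) \<le> P f + c"
    using *[OF gamble_add[OF assms gamble_const], of c "- c"] by simp
qed

lemma superadd_sum:
  assumes "finite I" "\<And>i. i \<in> I \<Longrightarrow> gamble (g i)"
  shows "(\<Sum>i\<in>I. P (g i)) \<le> P (\<lambda>x. \<Sum>i\<in>I. g i x)"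
  using assms
proof (induction I rule: finite_induct)
  case empty
  then show ?case by (simp add: zero)
next
  case (insert i I)
  then have "P (g i) + P (\<lambda>x. \<Sum>i\<in>I. g i x) \<le> P (\<lambda>x. g i x + (\<Sum>i\<in>I. g i x))"
    by (intro superadd gamble_sum) auto
  with insert show ?case by simp
qed

lemma event_bounds: "0 \<le> P (indicator A)" "P (indicator A) \<le> 1"
proof -
  show "0 \<le> P (indicator A)"
    by (rule ge_bound[OF gamble_indicator]) simp
  have "P (indicator A) \<le> P (\<lambda>x. 0 + 1)"
    by (intro mono gamble_const gamble_indicator) (simp add: indicator_def)
  then show "P (indicator A) \<le> 1"
    using add_const[OF gamble_const, of 0 1] zero by simp
qed

lemma event_mono: "A \<subseteq> B \<Longrightarrow> P (indicator A) \<le> P (indicator B)"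
  by (intro mono gamble_indicator) (auto simp: indicator_def)

lemma level_antimono: "level_family h A \<Longrightarrow> antimono (\<lambda>t. P (indicator (A t)))"
  by (intro antimonoI event_mono level_family_antimono)

text \<open>
  \<open>h - m\<close> lies above each layer sum \<open>\<delta> * (\<Sum>i. indicator (A (m + i * \<delta>)))\<close>, so superadditivity
  bounds \<open>P h - m\<close> from below by the Riemann sums of the integral.
\<close>

lemma ge_choquet:
  assumes lev: "level_family h A" and bnd: "\<And>x. m \<le> h x" "\<And>x. h x \<le> M"
  shows "m + integral {m..M} (\<lambda>t. P (indicator (A t))) \<le> P h"
proof (rule le_if_le_add_divide_nat)
  fix n :: nat
  assume n: "n \<ge> 1"
  define \<delta> where "\<delta> = (M - m) / real n"
  have \<delta>: "0 \<le> \<delta>" and M: "M = m + real n * \<delta>"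
    using n order_trans[OF bnd] by (auto simp: \<delta>_def)
  have h: "gamble h"
    by (rule gambleI[OF bnd])
  let ?\<phi> = "\<lambda>t. P (indicator (A t))"
  let ?s = "\<lambda>x. \<Sum>i=1..n. \<delta> * indicator (A (m + real i * \<delta>)) x"
  have s: "gamble ?s"
    by (intro gamble_sum gamble_cmult gamble_indicator) auto
  have "?s x + m \<le> h x" for x
  proof -
    have "?s x \<le> (\<Sum>i=1..n. \<delta> * of_bool (m + real i * \<delta> \<le> h x))"
      using lev \<delta> unfolding level_family_def
      by (intro sum_mono mult_left_mono) (auto simp: indicator_def)
    also have "\<dots> \<le> h x - m"
      using layer_count_le[OF \<delta> bnd(1)] by (simp only: sum_distrib_left)
    finally show ?thesis by simp
  qed
  then have "P ?s + m \<le> P h"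
    using mono[OF gamble_add[OF s gamble_const] h] add_const[OF s] by metis
  moreover have "(\<Sum>i=1..n. P (\<lambda>x. \<delta> * indicator (A (m + real i * \<delta>)) x)) \<le> P ?s"
    by (intro superadd_sum gamble_cmult gamble_indicator) auto
  then have "\<delta> * (\<Sum>i=1..n. ?\<phi> (m + real i * \<delta>)) \<le> P ?s"
    using \<delta> by (simp add: scale gamble_indicator sum_distrib_left)
  moreover have "integral {m..M} ?\<phi> \<le>
      \<delta> * (?\<phi> m - ?\<phi> M) + \<delta> * (\<Sum>i=1..n. ?\<phi> (m + real i * \<delta>))"
    using antimono_integral_bounds(2)[OF level_antimono[OF lev] \<delta>] unfolding M .
  moreover have "\<delta> * (?\<phi> m - ?\<phi> M) \<le> \<delta> * 1"
    using \<delta> event_bounds(2)[of "A m"] event_bounds(1)[of "A M"] by (intro mult_left_mono) auto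
  ultimately show "m + integral {m..M} ?\<phi> \<le> P h + (M - m) / real n"
    unfolding \<delta>_def[symmetric] by simp
qed

lemma event_compl: "P (indicator (- A)) = 1 - conjugate P (indicator A)"
proof -
  have "indicator (- A) = (\<lambda>x. - indicator A x + (1::real))"
    by (auto simp: indicator_def fun_eq_iff)
  then show ?thesis
    using add_const[OF gamble_uminus[OF gamble_indicator], of A 1] by (simp add: conjugate_def)
qed

end

section \<open>Expectation of a random interval\<close>

text \<open>
  A p-box written in terms of the level \<open>Z v\<close> instead of \<open>v\<close>. Extending both cdfs to all real levels
  makes a negative level stand for the empty down-set, so that the slabs below include those
  containing the bottom class.
\<close>

locale level_p_box =
  fixes Z :: "'a \<Rightarrow> real" and L U :: "real \<Rightarrow> real"
  assumes range_Z: "range Z = {0..1}"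
    and mono_L: "mono L" and mono_U: "mono U" and L_le_U: "L t \<le> U t"
    and U_neg: "t < 0 \<Longrightarrow> U t = 0" and L_neg: "t < 0 \<Longrightarrow> L t = 0"
    and U_ge_1: "1 \<le> t \<Longrightarrow> U t = 1" and L_ge_1: "1 \<le> t \<Longrightarrow> L t = 1"
begin

definition slab :: "real \<Rightarrow> real \<Rightarrow> 'a set"
  where "slab a b = {v. a < Z v \<and> Z v \<le> b}"

text \<open>
  The pairs \<open>(a, b)\<close> whose slabs generate the filter attached to \<open>u\<close>. Both inequalities are strict so
  that a given pair is admissible for an open set of \<open>u\<close>; all sets to be measured are then open.
\<close>

definition bracketing :: "real \<Rightarrow> (real \<times> real) set"
  where "bracketing u = {(a, b). U a < u \<and> u < L b}"

text \<open>
  The lower limit of \<open>f\<close> along the filter generated by the slabs bracketing \<open>u\<close>.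
\<close>

definition core :: "('a \<Rightarrow> real) \<Rightarrow> real \<Rightarrow> real"
  where "core f u = (SUP (a, b)\<in>bracketing u. INF v\<in>slab a b. f v)"

abbreviation unif :: "real measure"
  where "unif \<equiv> lebesgue_on {0<..<1}"

definition core_prevision :: "('a \<Rightarrow> real) \<Rightarrow> real"
  where "core_prevision f = integral\<^sup>L unif (core f)"

text \<open>
  Those \<open>u\<close> whose filter contains \<open>A\<close>, i.e. where the core of the indicator of \<open>A\<close> is \<open>1\<close>.
\<close>

definition hit :: "'a set \<Rightarrow> real set"
  where "hit A = (\<Union>(a, b)\<in>{(a, b). slab a b \<subseteq> A}. {U a<..<L b})"

lemma U_nonneg: "0 \<le> U a"
  using monoD[OF mono_U, of "min a (-1)" a] U_neg[of "min a (-1)"] by simp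

lemma L_le_1: "L b \<le> 1"
  using monoD[OF mono_L, of b "max b 1"] L_ge_1[of "max b 1"] by simp

text \<open>
  The point at the upper end of the slab, or at level \<open>c\<close> if that is lower, with levels above \<open>1\<close> cut
  off. It exists because \<open>Z\<close> is onto \<open>[0,1]\<close> and \<open>U a < L b\<close> forces \<open>a < b\<close>, \<open>a < 1\<close> and \<open>0 \<le> b\<close>. Such
  points make the filters proper and determine the hit sets of half-lines.
\<close>

lemma slab_point:
  assumes "U a < L b" "a < c" "0 \<le> c"
  obtains v where "v \<in> slab a b" "Z v = min (min b c) 1"
proof -
  have "\<not> b \<le> a"
    using assms(1) L_le_U[of b] monoD[OF mono_U, of b a] by linarith
  moreover have "a < 1"
    using assms(1) L_le_1[of b] U_ge_1[of a] by fastforce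
  moreover have "0 \<le> b"
    using assms(1) U_nonneg[of a] L_neg[of b] by fastforce
  ultimately have z: "min (min b c) 1 \<in> range Z" "a < min (min b c) 1"
    using assms range_Z by auto
  then obtain v where "Z v = min (min b c) 1"
    by (metis imageE)
  with z show thesis
    by (intro that[of v]) (auto simp: slab_def)
qed

lemma slab_nonempty:
  assumes "U a < L b"
  shows "slab a b \<noteq> {}"
proof -
  have "a < 1"
    using assms L_le_1[of b] U_ge_1[of a] by fastforce
  then show ?thesis
    using slab_point[OF assms, of 1] by auto
qed

lemma bracketing_nonempty:
  assumes "u \<in> {0<..<1}"
  shows "bracketing u \<noteq> {}"
proof -
  have "(-1, 1) \<in> bracketing u"
    using assms U_neg[of "-1"] L_ge_1[of 1] by (simp add: bracketing_def)
  then show ?thesis by blast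
qed

lemma core_bdd:
  assumes "gamble f"
  shows "bdd_above ((\<lambda>(a, b). INF v\<in>slab a b. f v) ` bracketing u)"
proof -
  obtain B where B: "\<bar>f x\<bar> \<le> B" for x
    using assms unfolding gamble_iff by blast
  have "(INF v\<in>slab a b. f v) \<le> B" if ab: "(a, b) \<in> bracketing u" for a b
  proof -
    have "U a < L b"
      using ab by (auto simp: bracketing_def)
    then obtain v where "v \<in> slab a b"
      using slab_nonempty by blast
    then show ?thesis
      using B[of v] by (intro cINF_lower2[OF gamble_bdd(1)[OF assms]]) auto
  qed
  then show ?thesis
    by (intro bdd_aboveI2[of _ _ B]) auto
qed

lemma less_core_iff:
  assumes "gamble f" "u \<in> {0<..<1}"
  shows "t < core f u \<longleftrightarrow> (\<exists>a b. U a < u \<and> u < L b \<and> t < (INF v\<in>slab a b. f v))"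
  unfolding core_def less_cSUP_iff[OF bracketing_nonempty[OF assms(2)] core_bdd[OF assms(1)]]
  by (auto simp: bracketing_def)

lemma core_ge:
  assumes "gamble f" "U a < u" "u < L b" "\<And>v. v \<in> slab a b \<Longrightarrow> c \<le> f v"
  shows "c \<le> core f u"
proof -
  have "c \<le> (INF v\<in>slab a b. f v)"
    using assms slab_nonempty[of a b] by (intro cINF_greatest) auto
  also have "\<dots> \<le> core f u"
    unfolding core_def using assms
    by (intro cSUP_upper2[OF core_bdd[OF assms(1)], of "(a, b)"]) (auto simp: bracketing_def)
  finally show ?thesis .
qed

lemma less_coreE:
  assumes "t < core f u" "gamble f" "u \<in> {0<..<1}"
  obtains a b where "U a < u" "u < L b" "\<And>v. v \<in> slab a b \<Longrightarrow> t < f v"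
proof -
  obtain a b where ab: "U a < u" "u < L b" "t < (INF v\<in>slab a b. f v)"
    using assms less_core_iff by blast
  have "t < f v" if "v \<in> slab a b" for v
    using ab(3) cINF_lower[OF gamble_bdd(1)[OF assms(2)] that] by (rule less_le_trans)
  with ab that show thesis by blast
qed

lemma core_const_le:
  assumes "gamble f" "u \<in> {0<..<1}" "\<And>x. f x \<le> c"
  shows "core f u \<le> c"
proof (rule ccontr)
  assume "\<not> ?thesis"
  then obtain a b where "U a < u" "u < L b" "\<And>v. v \<in> slab a b \<Longrightarrow> c < f v"
    using less_coreE[OF _ assms(1,2), of c] by auto
  then show False
    using slab_nonempty[of a b] assms(3) by (meson ex_in_conv leD less_trans)
qed

lemma core_const_ge:
  assumes "gamble f" "u \<in> {0<..<1}" "\<And>x. c \<le> f x"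
  shows "c \<le> core f u"
  using core_ge[OF assms(1), of "-1" u 1 c] U_neg[of "-1"] L_ge_1[of 1] assms by auto

text \<open>
  Lower limits are superadditive because two bracketing slabs intersect in a bracketing slab.
\<close>

lemma core_superadd:
  assumes "gamble f" "gamble g" "u \<in> {0<..<1}"
  shows "core f u + core g u \<le> core (\<lambda>x. f x + g x) u"
proof (rule ccontr)
  \<comment> \<open>a third of the gap, so that giving up one \<open>e\<close> for each summand still leaves one\<close>
  define e where "e = (core f u + core g u - core (\<lambda>x. f x + g x) u) / 3"
  assume "\<not> ?thesis"
  then have e: "0 < e"
    by (simp add: e_def)
  obtain a b where ab: "U a < u" "u < L b" "\<And>v. v \<in> slab a b \<Longrightarrow> core f u - e < f v"
    using less_coreE[OF _ assms(1,3), of "core f u - e"] e by auto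
  obtain c d where cd: "U c < u" "u < L d" "\<And>v. v \<in> slab c d \<Longrightarrow> core g u - e < g v"
    using less_coreE[OF _ assms(2,3), of "core g u - e"] e by auto
  have "(core f u - e) + (core g u - e) \<le> core (\<lambda>x. f x + g x) u"
  proof (rule core_ge)
    show "U (max a c) < u" "u < L (min b d)"
      using ab cd by (auto simp: max_def min_def)
    show "(core f u - e) + (core g u - e) \<le> f v + g v" if "v \<in> slab (max a c) (min b d)" for v
      using ab(3)[of v] cd(3)[of v] that by (auto simp: slab_def)
  qed (intro gamble_add assms)
  with e show False
    by (simp add: e_def field_simps)
qed

lemma core_scale:
  assumes "gamble f" "u \<in> {0<..<1}" "0 \<le> c"
  shows "core (\<lambda>x. c * f x) u = c * core f u"
proof (cases "c = 0")
  case True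
  then show ?thesis
    using core_const_le[OF gamble_const assms(2), of 0 0] core_const_ge[OF gamble_const assms(2), of 0 0]
    by simp
next
  case False
  have *: "d * core g u \<le> core (\<lambda>x. d * g x) u" if g: "gamble g" and d: "0 < d" for d g
  proof (rule ccontr)
    assume "\<not> ?thesis"
    then have "core (\<lambda>x. d * g x) u / d < core g u"
      using d by (simp add: field_simps)
    then obtain t where t: "core (\<lambda>x. d * g x) u / d < t" "t < core g u"
      using dense by blast
    obtain a b where "U a < u" "u < L b" "\<And>v. v \<in> slab a b \<Longrightarrow> t < g v"
      using less_coreE[OF t(2) g assms(2)] by blast
    then have "d * t \<le> core (\<lambda>x. d * g x) u"
      using d by (intro core_ge gamble_cmult g) (auto intro: less_imp_le)
    with t(1) d show False
      by (simp add: field_simps)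
  qed
  have c: "0 < c"
    using False assms by simp
  have "inverse c * core (\<lambda>x. c * f x) u \<le> core f u"
    using *[OF gamble_cmult[OF assms(1)], of "inverse c" c] c by (simp add: mult.assoc[symmetric])
  then show ?thesis
    using *[OF assms(1) c] c by (simp add: field_simps)
qed

text \<open>
  The core is lower semicontinuous: each superlevel set is a union of open intervals \<open>(U a, L b)\<close>.
\<close>

lemma core_measurable:
  assumes "gamble f"
  shows "core f \<in> borel_measurable unif"
  unfolding borel_measurable_iff_greater
proof
  fix t
  have "{u \<in> space unif. t < core f u}
      = {0<..<1} \<inter> (\<Union>(a, b)\<in>{(a, b). t < (INF v\<in>slab a b. f v)}. {U a<..<L b})"
    using less_core_iff[OF assms] by (auto; blast)
  also have "\<dots> \<in> sets unif"
  proof (intro sets_restrict_space_iff[THEN iffD2] conjI)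
    have "open ({0<..<1} \<inter> (\<Union>(a, b)\<in>{(a, b). t < (INF v\<in>slab a b. f v)}. {U a<..<L b}))"
      by (intro open_Int open_UN) auto
    then show "{0<..<1} \<inter> (\<Union>(a, b)\<in>{(a, b). t < (INF v\<in>slab a b. f v)}. {U a<..<L b}) \<in> sets lebesgue"
      by (simp add: borel_open)
  qed auto
  finally show "{u \<in> space unif. t < core f u} \<in> sets unif" .
qed

lemma finite_unit: "finite_measure unif"
  by (intro finite_measure_lebesgue_on lmeasurable_open) auto

lemma integrable_const_unit: "integrable unif (\<lambda>u. c::real)"
  by (rule finite_measure.integrable_const[OF finite_unit])

lemma integral_const_unit: "integral\<^sup>L unif (\<lambda>u. c::real) = c"
  by (simp add: measure_restrict_space)

lemma core_integrable:
  assumes "gamble f"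
  shows "integrable unif (core f)"
proof -
  obtain B where B: "\<bar>f x\<bar> \<le> B" for x
    using assms unfolding gamble_iff by blast
  then have "- B \<le> f x" "f x \<le> B" for x
    by (simp_all add: abs_le_iff minus_le_iff)
  then have "\<bar>core f u\<bar> \<le> B" if "u \<in> {0<..<1}" for u
    using core_const_le[OF assms that, of B] core_const_ge[OF assms that, of "- B"] by (simp add: abs_le_iff)
  then show ?thesis
    by (intro finite_measure.integrable_const_bound[OF finite_unit, of _ B] core_measurable assms)
       (auto intro!: AE_I2)
qed

lemma core_prevision_coherent: "coherent_lower_prevision core_prevision"
  unfolding coherent_lower_prevision_def
proof (intro conjI allI impI)
  fix f :: "'a \<Rightarrow> real"
  assume f: "gamble f"
  have "(INF x. f x) = integral\<^sup>L unif (\<lambda>u. INF x. f x)"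
    by (simp only: integral_const_unit)
  also have "\<dots> \<le> core_prevision f"
    unfolding core_prevision_def
    by (intro integral_mono core_integrable integrable_const_unit f core_const_ge)
       (auto intro: cINF_lower[OF gamble_bdd(1)[OF f]])
  finally show "(INF x. f x) \<le> core_prevision f" .
next
  fix f :: "'a \<Rightarrow> real" and c :: real
  assume f: "gamble f" "0 \<le> c"
  have "core_prevision (\<lambda>x. c * f x) = integral\<^sup>L unif (\<lambda>u. c * core f u)"
    unfolding core_prevision_def by (intro Bochner_Integration.integral_cong core_scale f) auto
  then show "core_prevision (\<lambda>x. c * f x) = c * core_prevision f"
    by (simp add: core_prevision_def)
next
  fix f g :: "'a \<Rightarrow> real"
  assume fg: "gamble f" "gamble g"
  have "core_prevision f + core_prevision g
      = integral\<^sup>L unif (\<lambda>u. core f u + core g u)"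
    unfolding core_prevision_def by (intro Bochner_Integration.integral_add[symmetric] core_integrable fg)
  also have "\<dots> \<le> core_prevision (\<lambda>x. f x + g x)"
    unfolding core_prevision_def
    by (intro integral_mono Bochner_Integration.integrable_add core_integrable gamble_add fg core_superadd) auto
  finally show "core_prevision f + core_prevision g \<le> core_prevision (\<lambda>x. f x + g x)" .
qed

lemma hitI: "slab a b \<subseteq> A \<Longrightarrow> U a < u \<Longrightarrow> u < L b \<Longrightarrow> u \<in> hit A"
  by (force simp: hit_def)

lemma hitE:
  assumes "u \<in> hit A"
  obtains a b where "slab a b \<subseteq> A" "U a < u" "u < L b"
  using assms by (auto simp: hit_def)

lemma open_hit: "open (hit A)"
  unfolding hit_def by (intro open_UN) auto

lemma hit_subset: "hit A \<subseteq> {0<..<1}"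
proof
  fix u assume "u \<in> hit A"
  then obtain a b where "U a < u" "u < L b"
    by (rule hitE)
  then show "u \<in> {0<..<1}"
    using U_nonneg[of a] L_le_1[of b] by simp
qed

lemma core_indicator:
  assumes u: "u \<in> {0<..<1}"
  shows "core (indicator A) u = indicator (hit A) u"
proof (cases "u \<in> hit A")
  case True
  then obtain a b where "slab a b \<subseteq> A" "U a < u" "u < L b"
    by (rule hitE)
  then have "1 \<le> core (indicator A) u"
    by (intro core_ge[OF gamble_indicator]) (auto simp: indicator_def)
  moreover have "core (indicator A) u \<le> 1"
    by (rule core_const_le[OF gamble_indicator u]) (simp add: indicator_def)
  ultimately show ?thesis using True by simp
next
  case False
  have "\<not> 0 < core (indicator A) u"
  proof
    assume "0 < core (indicator A) u"
    then obtain a b where "U a < u" "u < L b" "\<And>v. v \<in> slab a b \<Longrightarrow> 0 < (indicator A v :: real)"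
      using less_coreE[OF _ gamble_indicator u, of 0 A] by blast
    then have "u \<in> hit A"
      by (intro hitI[of a b]) (auto simp: indicator_def split: if_splits)
    with False show False ..
  qed
  moreover have "0 \<le> core (indicator A) u"
    by (rule core_const_ge[OF gamble_indicator u]) simp
  ultimately show ?thesis using False by simp
qed

lemma core_prevision_event: "core_prevision (indicator A) = measure lebesgue (hit A)"
proof -
  have "core_prevision (indicator A) = integral\<^sup>L unif (indicator (hit A))"
    unfolding core_prevision_def by (intro Bochner_Integration.integral_cong core_indicator) auto
  also have "\<dots> = measure lebesgue (hit A)"
    using hit_subset[of A] by (simp add: measure_restrict_space Int_absorb2)
  finally show ?thesis .
qed

text \<open>
  This lemma and the next make the functional take the values that the p-box prescribes. A bracketing
  slab can lie below the level \<open>z\<close> without \<open>b \<le> z\<close> only if \<open>z \<ge> 1\<close>, since otherwise it contains a point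
  of level above \<open>z\<close>; dually for slabs above \<open>z\<close>.
\<close>

lemma hit_down_set: "hit {v. Z v \<le> z} = {0<..<L z}"
proof (rule antisym; rule subsetI)
  fix u assume "u \<in> hit {v. Z v \<le> z}"
  then obtain a b where ab: "slab a b \<subseteq> {v. Z v \<le> z}" "U a < u" "u < L b"
    by (rule hitE)
  have "U a < L b" using ab by simp
  moreover have "a < 1"
    using ab L_le_1[of b] U_ge_1[of a] by fastforce
  ultimately obtain v where "v \<in> slab a b" "Z v = min (min b 1) 1"
    using slab_point[of a b 1] by auto
  with ab(1) have "min b 1 \<le> z" by auto
  moreover have "L b = L (min b 1)"
    using L_ge_1[of 1] L_ge_1[of b] by (auto simp: min_def)
  ultimately have "L b \<le> L z"
    using monoD[OF mono_L] by metis
  with ab show "u \<in> {0<..<L z}"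
    using U_nonneg[of a] by auto
next
  fix u assume "u \<in> {0<..<L z}"
  then show "u \<in> hit {v. Z v \<le> z}"
    using U_neg[of "-1"] by (intro hitI[of "-1" z]) (auto simp: slab_def)
qed

lemma hit_up_set: "hit {v. z < Z v} = {U z<..<1}"
proof (rule antisym; rule subsetI)
  fix u assume u: "u \<in> hit {v. z < Z v}"
  then obtain a b where ab: "slab a b \<subseteq> {v. z < Z v}" "U a < u" "u < L b"
    by (rule hitE)
  have "U a < L b" using ab by simp
  have "\<not> u \<le> U z"
  proof
    assume "u \<le> U z"
    then have "\<not> z \<le> a" "\<not> z < 0"
      using ab(2) U_nonneg[of a] U_neg[of z] monoD[OF mono_U, of z a] by linarith+
    then have "a < z" "0 \<le> z"
      by simp_all
    then obtain v where "v \<in> slab a b" "Z v = min (min b z) 1"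
      using slab_point[OF \<open>U a < L b\<close>] by blast
    with ab(1) show False by auto
  qed
  then show "u \<in> {U z<..<1}"
    using subsetD[OF hit_subset u] by simp
next
  fix u assume "u \<in> {U z<..<1}"
  then show "u \<in> hit {v. z < Z v}"
    using L_ge_1[of 1] by (intro hitI[of z 1]) (auto simp: slab_def)
qed

lemma core_prevision_down_set: "core_prevision (indicator {v. Z v \<le> z}) = L z"
proof -
  have "0 \<le> L z"
    using monoD[OF mono_L, of "min z (-1)" z] L_neg[of "min z (-1)"] by simp
  then show ?thesis
    by (simp add: core_prevision_event hit_down_set)
qed

lemma core_prevision_up_set: "core_prevision (indicator {v. z < Z v}) = 1 - U z"
proof -
  have "U z \<le> 1"
    using monoD[OF mono_U, of z "max z 1"] U_ge_1[of "max z 1"] by simp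
  then show ?thesis
    by (simp add: core_prevision_event hit_up_set)
qed

text \<open>
  If the core of \<open>h\<close> at \<open>u\<close> exceeds \<open>t\<close>, then some bracketing slab lies inside \<open>A t\<close>, so the core of the
  indicator of \<open>A t\<close> is \<open>1\<close> there. Hence the core of \<open>h\<close> is bounded by a layer sum of cores of events,
  with an error of one step. A coherent lower prevision is only superadditive on layer sums, but
  integration over \<open>u\<close> is additive on this one, hence the bound in the other direction.
\<close>

lemma core_prevision_le_choquet:
  assumes lev: "level_family h A" and bnd: "\<And>x. m \<le> h x" "\<And>x. h x \<le> M"
  shows "core_prevision h \<le> m + integral {m..M} (\<lambda>t. core_prevision (indicator (A t)))"
proof (rule le_if_le_add_divide_nat)
  interpret coherent core_prevision
    by standard (rule core_prevision_coherent)
  fix n :: nat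
  assume n: "n \<ge> 1"
  define \<delta> where "\<delta> = (M - m) / real n"
  have \<delta>: "0 \<le> \<delta>" and M: "M = m + real n * \<delta>"
    using n order_trans[OF bnd] by (auto simp: \<delta>_def)
  have h: "gamble h"
    by (rule gambleI[OF bnd])
  let ?\<phi> = "\<lambda>t. core_prevision (indicator (A t))"
  let ?s = "\<lambda>u. m + \<delta> + (\<Sum>i=1..n. \<delta> * core (indicator (A (m + real i * \<delta>))) u)"
  have s: "integrable unif (\<lambda>u. \<Sum>i=1..n. \<delta> * core (indicator (A (m + real i * \<delta>))) u)"
    by (intro Bochner_Integration.integrable_sum integrable_mult_right core_integrable gamble_indicator)
  have "core h u \<le> ?s u" if u: "u \<in> {0<..<1}" for u
  proof -
    have "core h u \<le> M"
      by (rule core_const_le[OF h u bnd(2)])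
    then have "core h u \<le> m + real (Suc n) * \<delta>"
      using \<delta> by (simp add: M algebra_simps)
    then have "core h u \<le> m + \<delta> + \<delta> * (\<Sum>i=1..n. of_bool (m + real i * \<delta> < core h u))"
      by (rule layer_count_ge) (rule \<delta>)
    also have "\<dots> = m + \<delta> + (\<Sum>i=1..n. \<delta> * of_bool (m + real i * \<delta> < core h u))"
      by (simp only: sum_distrib_left)
    also have "\<dots> \<le> ?s u"
    proof (intro add_left_mono sum_mono mult_left_mono \<delta>)
      fix i
      let ?t = "m + real i * \<delta>"
      show "of_bool (?t < core h u) \<le> core (indicator (A ?t)) u"
      proof (cases "?t < core h u")
        case True
        then obtain a b where "U a < u" "u < L b" "\<And>v. v \<in> slab a b \<Longrightarrow> ?t < h v"
          using less_coreE[OF _ h u] by blast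
        then have "1 \<le> core (indicator (A ?t)) u"
          using lev unfolding level_family_def
          by (intro core_ge[OF gamble_indicator]) (auto simp: indicator_def)
        with True show ?thesis by simp
      next
        case False
        then show ?thesis
          using core_const_ge[OF gamble_indicator u, of 0 "A ?t"] by simp
      qed
    qed
    finally show ?thesis .
  qed
  then have "core_prevision h \<le> integral\<^sup>L unif ?s"
    unfolding core_prevision_def
    by (intro integral_mono core_integrable h Bochner_Integration.integrable_add[OF integrable_const_unit s]) auto
  also have "\<dots> = integral\<^sup>L unif (\<lambda>u. m + \<delta>) +
      integral\<^sup>L unif (\<lambda>u. \<Sum>i=1..n. \<delta> * core (indicator (A (m + real i * \<delta>))) u)"
    by (intro Bochner_Integration.integral_add integrable_const_unit s)
  also have "\<dots> = m + \<delta> + \<delta> * (\<Sum>i=1..n. ?\<phi> (m + real i * \<delta>))"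
    unfolding integral_const_unit
    by (subst Bochner_Integration.integral_sum)
       (auto intro: integrable_mult_right core_integrable gamble_indicator
         simp: core_prevision_def sum_distrib_left)
  also have "\<dots> \<le> m + \<delta> + integral {m..M} ?\<phi>"
    using antimono_integral_bounds(1)[OF level_antimono[OF lev] \<delta>, of m n] unfolding M by simp
  finally show "core_prevision h \<le> m + integral {m..M} ?\<phi> + (M - m) / real n"
    unfolding \<delta>_def[symmetric] by simp
qed

lemma core_prevision_choquet:
  assumes "level_family h A" "\<And>x. m \<le> h x" "\<And>x. h x \<le> M"
  shows "core_prevision h = m + integral {m..M} (\<lambda>t. core_prevision (indicator (A t)))"
proof -
  interpret coherent core_prevision
    by standard (rule core_prevision_coherent)
  show ?thesis
    by (intro antisym core_prevision_le_choquet ge_choquet assms)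
qed

text \<open>
  A slab contains with a point its whole equivalence class, so a lower bound for \<open>f\<close> on a slab is one
  for its lower oscillation as well.
\<close>

lemma core_class_inf:
  assumes f: "gamble f" and u: "u \<in> {0<..<1}"
  shows "core (\<lambda>v. lower_osc Z f (Z v)) u = core f u"
proof (rule antisym)
  let ?g = "\<lambda>v. lower_osc Z f (Z v)"
  have g: "gamble ?g"
    by (rule gamble_lower_osc[OF f])
  show "core ?g u \<le> core f u"
  proof (rule dense_le)
    fix t assume "t < core ?g u"
    then obtain a b where ab: "U a < u" "u < L b" "\<And>v. v \<in> slab a b \<Longrightarrow> t < ?g v"
      using less_coreE[OF _ g u] by blast
    then show "t \<le> core f u"
      using lower_osc_le[OF f, of Z]
      by (intro core_ge[OF f ab(1,2)]) (meson less_imp_le less_le_trans)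
  qed
  show "core f u \<le> core ?g u"
  proof (rule dense_le)
    fix t assume "t < core f u"
    then obtain a b where ab: "U a < u" "u < L b" "\<And>v. v \<in> slab a b \<Longrightarrow> t < f v"
      using less_coreE[OF _ f u] by blast
    have "t \<le> ?g v" if "v \<in> slab a b" for v
      unfolding lower_osc_def
    proof (rule cINF_greatest)
      show "t \<le> f w" if "w \<in> {w. Z w = Z v}" for w
        using that \<open>v \<in> slab a b\<close> ab(3)[of w] by (auto simp: slab_def)
    qed auto
    with ab show "t \<le> core ?g u"
      by (intro core_ge[OF g]) auto
  qed
qed

lemma core_prevision_class_inf:
  assumes "gamble f"
  shows "core_prevision (\<lambda>v. lower_osc Z f (Z v)) = core_prevision f"
  unfolding core_prevision_def
  by (intro Bochner_Integration.integral_cong core_class_inf assms) auto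

end

section \<open>Minimality of the random-interval expectation\<close>

locale p_box_extension = level_p_box Z L U + coherent P
  for Z :: "'a \<Rightarrow> real" and L U and P :: "('a \<Rightarrow> real) \<Rightarrow> real" +
  assumes down_ge: "L z \<le> P (indicator {v. Z v \<le> z})"
    and up_ge: "1 - U z \<le> P (indicator {v. z < Z v})"
begin

text \<open>
  The indicator of a slab is at least the sum of the indicators of its two half-lines minus \<open>1\<close>, so
  superadditivity transfers the bounds on half-lines to slabs.
\<close>

lemma slab_ge: "L b - U a \<le> P (indicator (slab a b))"
proof -
  let ?s = "\<lambda>v. indicator {v. Z v \<le> b} v + indicator {v. a < Z v} v :: real"
  have s: "gamble ?s"
    by (intro gamble_add gamble_indicator)
  have "L b + (1 - U a) \<le> P ?s"
    using superadd[OF gamble_indicator gamble_indicator, of "{v. Z v \<le> b}" "{v. a < Z v}"]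
      down_ge[of b] up_ge[of a] by linarith
  moreover have "P (\<lambda>v. ?s v + (- 1)) \<le> P (indicator (slab a b))"
    by (intro mono gamble_add gamble_indicator gamble_const) (auto simp: indicator_def slab_def)
  ultimately show ?thesis
    using add_const[OF s, of "-1"] by simp
qed

text \<open>
  If the slabs are pairwise disjoint, their indicators add up to at most the indicator of \<open>A\<close>, and
  superadditivity gives the bound. Two slabs that meet have a slab as their union, and the interval
  of that slab contains both of the given intervals; replacing them by it shortens the family.
\<close>

lemma finite_cover_le_event:
  assumes "finite J" "\<And>a b. (a, b) \<in> J \<Longrightarrow> slab a b \<subseteq> A"
  shows "measure lebesgue (\<Union>(a, b)\<in>J. {U a<..<L b}) \<le> P (indicator A)"
  using assms
proof (induction "card J" arbitrary: J rule: less_induct)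
  case less
  show ?case
  proof (cases "\<exists>p\<in>J. \<exists>q\<in>J. p \<noteq> q \<and> case_prod slab p \<inter> case_prod slab q \<noteq> {}")
    case True
    then obtain p q v where pq: "p \<in> J" "q \<in> J" "p \<noteq> q" "v \<in> case_prod slab p" "v \<in> case_prod slab q"
      by blast
    obtain a b c d where "p = (a, b)" "q = (c, d)"
      by fastforce
    with pq have ab: "(a, b) \<in> J" and cd: "(c, d) \<in> J" and ne: "(a, b) \<noteq> (c, d)"
      and v: "v \<in> slab a b" "v \<in> slab c d"
      by auto
    define K where "K = insert (min a c, max b d) (J - {(a, b), (c, d)})"
    have "card (J - {(a, b), (c, d)}) + 2 = card J"
      using less.prems(1) ab cd ne card_Diff_subset[of "{(a, b), (c, d)}" J]
        card_mono[of J "{(a, b), (c, d)}"] by simp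
    moreover have "card K \<le> card (J - {(a, b), (c, d)}) + 1"
      unfolding K_def by (simp add: card_insert_if less.prems(1))
    ultimately have small: "card K < card J"
      by linarith
    have K_fin: "finite K"
      using less.prems(1) by (simp add: K_def)
    have "slab (min a c) (max b d) = slab a b \<union> slab c d"
      using v by (auto simp: slab_def)
    then have K_sub: "slab x y \<subseteq> A" if "(x, y) \<in> K" for x y
      using that less.prems(2) ab cd unfolding K_def by auto
    have "{U a<..<L b} \<union> {U c<..<L d} \<subseteq> {U (min a c)<..<L (max b d)}"
      using monoD[OF mono_U, of "min a c" a] monoD[OF mono_U, of "min a c" c]
        monoD[OF mono_L, of b "max b d"] monoD[OF mono_L, of d "max b d"] by auto
    then have "(\<Union>(a, b)\<in>J. {U a<..<L b}) \<subseteq> (\<Union>(a, b)\<in>K. {U a<..<L b})"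
      unfolding K_def by fastforce
    then have "measure lebesgue (\<Union>(a, b)\<in>J. {U a<..<L b}) \<le> measure lebesgue (\<Union>(a, b)\<in>K. {U a<..<L b})"
      using less.prems(1) K_fin
      by (intro measure_mono_fmeasurable fmeasurableD fmeasurable.finite_UN) auto
    also have "\<dots> \<le> P (indicator A)"
      by (rule less.hyps[OF small K_fin K_sub])
    finally show ?thesis .
  next
    case False
    let ?s = "\<lambda>v. \<Sum>p\<in>J. indicator (case_prod slab p) v :: real"
    have "measure lebesgue (\<Union>p\<in>J. case p of (a, b) \<Rightarrow> {U a<..<L b})
        \<le> (\<Sum>p\<in>J. measure lebesgue (case p of (a, b) \<Rightarrow> {U a<..<L b}))"
      by (rule measure_UNION_le[OF less.prems(1)]) auto
    also have "\<dots> \<le> (\<Sum>p\<in>J. P (indicator (case_prod slab p)))"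
    proof (rule sum_mono)
      fix p :: "real \<times> real"
      obtain a b where "p = (a, b)" by fastforce
      then show "measure lebesgue (case p of (a, b) \<Rightarrow> {U a<..<L b}) \<le> P (indicator (case_prod slab p))"
        using slab_ge[of b a] event_bounds(1)[of "slab a b"] by (cases "U a \<le> L b") auto
    qed
    also have "\<dots> \<le> P ?s"
      by (intro superadd_sum less.prems(1) gamble_indicator)
    also have "\<dots> \<le> P (indicator A)"
    proof (intro mono gamble_sum gamble_indicator less.prems(1))
      fix v
      show "?s v \<le> indicator A v"
      proof (cases "\<exists>p\<in>J. v \<in> case_prod slab p")
        case True
        then obtain p where p: "p \<in> J" "v \<in> case_prod slab p" by blast
        have "?s v = (\<Sum>q\<in>J. if q = p then 1 else 0)"
        proof (intro sum.cong refl)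
          fix q assume q: "q \<in> J"
          have "v \<notin> case_prod slab q" if "q \<noteq> p"
            using False p q that by blast
          with p(2) show "indicator (case_prod slab q) v = (if q = p then 1 else 0 :: real)"
            by simp
        qed
        also have "\<dots> = 1"
          using p less.prems(1) by simp
        finally show ?thesis
          using p less.prems(2) by (auto simp: indicator_def split: prod.splits)
      next
        case none: False
        then have "?s v = 0"
          by (intro sum.neutral) (auto simp: indicator_def)
        then show ?thesis by simp
      qed
    qed
    finally show ?thesis .
  qed
qed

text \<open>
  A compact subset of the hit set of almost full measure needs only finitely many of its intervals.
\<close>

lemma core_prevision_event_le: "core_prevision (indicator A) \<le> P (indicator A)"
proof (rule field_le_epsilon)
  fix e :: real
  assume e: "0 < e"
  have bdd: "bounded (hit A)"
    by (rule bounded_subset[OF bounded_closed_interval[of 0 1]]) (use hit_subset in fastforce)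
  then have hit: "hit A \<in> lmeasurable"
    by (intro lmeasurable_open open_hit)
  obtain K where K: "closed K" "K \<subseteq> hit A" "hit A - K \<in> lmeasurable" "emeasure lebesgue (hit A - K) < ennreal e"
    using sets_lebesgue_inner_closed[OF fmeasurableD[OF hit] e] .
  have "compact K"
    using K(1) bounded_subset[OF bdd K(2)] by (simp add: compact_eq_bounded_closed)
  then obtain J where J: "J \<subseteq> {(a, b). slab a b \<subseteq> A}" "finite J" "K \<subseteq> (\<Union>(a, b)\<in>J. {U a<..<L b})"
    using compactE_image[of K "{(a, b). slab a b \<subseteq> A}" "\<lambda>(a, b). {U a<..<L b}"] K(2)
    unfolding hit_def by (metis (no_types, lifting) case_prod_beta' open_greaterThanLessThan)
  have "measure lebesgue (hit A) \<le> measure lebesgue (K \<union> (hit A - K))"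
    using hit K \<open>compact K\<close> by (intro measure_mono_fmeasurable) (auto intro: lmeasurable_compact)
  also have "\<dots> \<le> measure lebesgue K + measure lebesgue (hit A - K)"
    using K(3) \<open>compact K\<close> by (intro measure_Un_le) (auto intro: fmeasurableD lmeasurable_compact)
  also have "measure lebesgue K \<le> measure lebesgue (\<Union>(a, b)\<in>J. {U a<..<L b})"
    using J \<open>compact K\<close>
    by (intro measure_mono_fmeasurable fmeasurable.finite_UN) (auto intro: fmeasurableD lmeasurable_compact)
  also have "\<dots> \<le> P (indicator A)"
    using J by (intro finite_cover_le_event) auto
  also have "measure lebesgue (hit A - K) \<le> e"
    using K(3,4) e by (simp add: emeasure_eq_measure2 ennreal_less_iff)
  finally show "core_prevision (indicator A) \<le> P (indicator A) + e"
    by (simp add: core_prevision_event)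
qed

text \<open>
  Between the two functionals lie their Choquet integrals, which are compared event by event.
\<close>

lemma core_prevision_le:
  assumes h: "gamble h"
  shows "core_prevision h \<le> P h"
proof -
  interpret C: coherent core_prevision
    by standard (rule core_prevision_coherent)
  obtain B where "\<bar>h x\<bar> \<le> B" for x
    using h unfolding gamble_iff by blast
  then have bnd: "- B \<le> h x" "h x \<le> B" for x
    by (simp_all add: abs_le_iff minus_le_iff)
  define A where "A t = {x. t \<le> h x}" for t
  have lev: "level_family h A"
    by (auto simp: level_family_def A_def)
  have "core_prevision h \<le> - B + integral {- B..B} (\<lambda>t. core_prevision (indicator (A t)))"
    by (rule core_prevision_le_choquet[OF lev bnd])
  also have "\<dots> \<le> - B + integral {- B..B} (\<lambda>t. P (indicator (A t)))"
    by (intro add_left_mono integral_le antimono_integrable_on C.level_antimono[OF lev]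
          level_antimono[OF lev] core_prevision_event_le)
  also have "\<dots> \<le> P h"
    by (rule ge_choquet[OF lev bnd])
  finally show ?thesis .
qed

end

section \<open>The natural extension of a p-box\<close>

text \<open>
  A cdf depends on its argument only through the level, so any point of the level may be chosen.
\<close>

definition level_cdf :: "('a \<Rightarrow> real) \<Rightarrow> ('a \<Rightarrow> real) \<Rightarrow> real \<Rightarrow> real"
  where "level_cdf Z F t = (if t < 0 then 0 else F (SOME x. Z x = min t 1))"

lemma level_cdf_point:
  assumes "range Z = {0..1}" "cdf_on Z one F" "0 \<le> t" "Z x = min t 1"
  shows "level_cdf Z F t = F x"
proof -
  have "Z (SOME y. Z y = min t 1) = Z x"
    using someI[of "\<lambda>y. Z y = min t 1" x] assms(4) by simp
  then have "F (SOME y. Z y = min t 1) = F x"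
    using assms(2) unfolding cdf_on_def by (intro antisym) auto
  then show ?thesis
    using assms(3) by (simp add: level_cdf_def)
qed

lemma level_cdf_eq:
  assumes "range Z = {0..1}" "cdf_on Z one F"
  shows "level_cdf Z F (Z x) = F x"
proof -
  have "Z x \<in> {0..1}"
    using assms(1) by blast
  then show ?thesis
    using level_cdf_point[OF assms, of "Z x" x] by simp
qed

lemma level_cdf_ge_1:
  assumes "range Z = {0..1}" "cdf_on Z one F" "Z one = 1" "1 \<le> t"
  shows "level_cdf Z F t = 1"
  using level_cdf_point[OF assms(1,2), of t one] assms(2-4) by (simp add: cdf_on_def)

lemma mono_level_cdf:
  assumes "range Z = {0..1}" "cdf_on Z one F"
  shows "mono (level_cdf Z F)"
proof (rule monoI)
  fix s t :: real
  assume "s \<le> t"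
  show "level_cdf Z F s \<le> level_cdf Z F t"
  proof (cases "s < 0")
    case True
    then show ?thesis
      using assms(2) by (simp add: level_cdf_def cdf_on_def)
  next
    case False
    then have "min s 1 \<in> range Z" "min t 1 \<in> range Z"
      using \<open>s \<le> t\<close> assms(1) by auto
    then obtain x y where xy: "Z x = min s 1" "Z y = min t 1"
      by (metis imageE)
    then have "Z x \<le> Z y"
      using \<open>s \<le> t\<close> by simp
    then show ?thesis
      using level_cdf_point[OF assms _ xy(1)] level_cdf_point[OF assms _ xy(2)] False \<open>s \<le> t\<close> assms(2)
      by (simp add: cdf_on_def)
  qed
qed

lemma level_p_box:
  assumes "range Z = {0..1}" "Z one = 1" "p_box Z one Fl Fu"
  shows "level_p_box Z (level_cdf Z Fl) (level_cdf Z Fu)"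
proof
  have cdf: "cdf_on Z one Fl" "cdf_on Z one Fu" and le: "Fl x \<le> Fu x" for x
    using assms(3) by (auto simp: p_box_def)
  show "range Z = {0..1}" by fact
  show "mono (level_cdf Z Fl)" "mono (level_cdf Z Fu)"
    by (rule mono_level_cdf[OF assms(1) cdf(1)], rule mono_level_cdf[OF assms(1) cdf(2)])
  show "level_cdf Z Fl t \<le> level_cdf Z Fu t" for t
    by (simp add: level_cdf_def le)
  show "level_cdf Z Fu t = 0" "level_cdf Z Fl t = 0" if "t < 0" for t
    using that by (simp_all add: level_cdf_def)
  show "level_cdf Z Fu t = 1" "level_cdf Z Fl t = 1" if "1 \<le> t" for t
    by (rule level_cdf_ge_1[OF assms(1) cdf(2) assms(2) that],
        rule level_cdf_ge_1[OF assms(1) cdf(1) assms(2) that])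
qed

lemma core_prevision_natural_extension:
  assumes Z: "range Z = {0..1}" "Z zero = 0" "Z one = 1" and box: "p_box Z one Fl Fu"
  shows "is_natural_extension Z zero one Fl Fu
    (level_p_box.core_prevision Z (level_cdf Z Fl) (level_cdf Z Fu))"
proof -
  interpret level_p_box Z "level_cdf Z Fl" "level_cdf Z Fu"
    by (rule level_p_box[OF Z(1,3) box])
  have cdf: "cdf_on Z one Fl" "cdf_on Z one Fu"
    using box by (auto simp: p_box_def)
  have Z_in: "0 \<le> Z v" "Z v \<le> 1" for v
    using range_Z by (auto simp: set_eq_iff image_iff)
  have cc: "cc_interval Z zero x = {v. Z v \<le> Z x}" for x
    using Z_in Z(2) by (auto simp: cc_interval_def)
  have oc: "oc_interval Z x one = {v. Z x < Z v}" for x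
    using Z_in Z(3) by (auto simp: oc_interval_def)
  show ?thesis
    unfolding is_natural_extension_def
  proof (intro conjI allI impI)
    show "extends_p_box Z zero one Fl Fu core_prevision"
      unfolding extends_p_box_def cc oc
      by (simp add: core_prevision_coherent core_prevision_down_set core_prevision_up_set
          level_cdf_eq[OF Z(1) cdf(1)] level_cdf_eq[OF Z(1) cdf(2)])
  next
    fix P and f :: "'a \<Rightarrow> real"
    assume ext: "extends_p_box Z zero one Fl Fu P" and f: "gamble f"
    interpret coherent P
      using ext by unfold_locales (simp add: extends_p_box_def)
    have one: "1 \<le> P (indicator UNIV)"
      by (rule ge_bound[OF gamble_indicator]) simp
    have "p_box_extension Z (level_cdf Z Fl) (level_cdf Z Fu) P"
    proof
      fix z
      consider "z < 0" | x where "z = Z x" | "1 < z"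
        using range_Z by (metis atLeastAtMost_iff imageE linorder_not_less)
      note cases = this
      show "level_cdf Z Fl z \<le> P (indicator {v. Z v \<le> z})"
      proof (cases rule: cases)
        case 1
        then show ?thesis by (simp add: L_neg event_bounds)
      next
        case 2
        then show ?thesis
          using ext unfolding extends_p_box_def cc by (simp add: level_cdf_eq[OF Z(1) cdf(1)])
      next
        case 3
        then have "{v. Z v \<le> z} = UNIV"
          using Z_in(2) by (force intro: order_trans)
        with one L_ge_1[of z] 3 show ?thesis by simp
      qed
      show "1 - level_cdf Z Fu z \<le> P (indicator {v. z < Z v})"
      proof (cases rule: cases)
        case 1
        then have "{v. z < Z v} = UNIV"
          using Z_in by (auto intro: less_le_trans)
        with one U_neg[OF 1] show ?thesis by simp
      next
        case 2
        then show ?thesis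
          using ext unfolding extends_p_box_def oc by (simp add: level_cdf_eq[OF Z(1) cdf(2)])
      next
        case 3
        then show ?thesis by (simp add: U_ge_1 event_bounds)
      qed
    qed
    then show "core_prevision f \<le> P f"
      using f by (rule p_box_extension.core_prevision_le)
  qed
qed

theorem proposition21:
  fixes Z :: "'a \<Rightarrow> real" and zero one :: 'a and Fl Fu f :: "'a \<Rightarrow> real"
    and E :: "('a \<Rightarrow> real) \<Rightarrow> real"
  assumes "range Z = {0..1}" and "Z zero = 0" and "Z one = 1"
    and "p_box Z one Fl Fu"
    and "E = natural_extension Z zero one Fl Fu"
    and "gamble f"
  shows "E f = (INF z\<in>{0..1}. lower_osc Z f z) +
      integral {(INF z\<in>{0..1}. lower_osc Z f z)..(SUP z\<in>{0..1}. lower_osc Z f z)}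
        (\<lambda>t. on_values E Z {z\<in>{0..1}. lower_osc Z f z \<ge> t})
    \<and> conjugate E f = (INF z\<in>{0..1}. upper_osc Z f z) +
      integral {(INF z\<in>{0..1}. upper_osc Z f z)..(SUP z\<in>{0..1}. upper_osc Z f z)}
        (\<lambda>t. on_values (conjugate E) Z {z\<in>{0..1}. upper_osc Z f z \<ge> t})"
proof -
  interpret level_p_box Z "level_cdf Z Fl" "level_cdf Z Fu"
    by (rule level_p_box[OF assms(1,3,4)])
  interpret C: coherent core_prevision
    by standard (rule core_prevision_coherent)
  have nat: "is_natural_extension Z zero one Fl Fu core_prevision"
    by (rule core_prevision_natural_extension[OF assms(1-4)])
  have "is_natural_extension Z zero one Fl Fu E"
    unfolding assms(5) natural_extension_def by (rule someI[of _ core_prevision]) (rule nat)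
  then have E: "E g = core_prevision g" if "gamble g" for g
    using nat that by (rule is_natural_extension_unique)
  have conj_E: "conjugate E g = conjugate core_prevision g" if "gamble g" for g
    unfolding conjugate_def by (simp add: E gamble_uminus that)
  have Z_in: "Z v \<in> {0..1}" for v
    using range_Z by blast
  have bdd: "bdd_below (lower_osc Z g ` {0..1})" "bdd_above (lower_osc Z g ` {0..1})" if "gamble g" for g
  proof -
    have "lower_osc Z g ` {0..1} = range (\<lambda>v. lower_osc Z g (Z v))"
      unfolding range_Z[symmetric] by (rule image_image)
    then show "bdd_below (lower_osc Z g ` {0..1})" "bdd_above (lower_osc Z g ` {0..1})"
      using gamble_bdd[OF gamble_lower_osc[OF that, of Z], of UNIV] by (simp_all only:)
  qed
  note f = \<open>gamble f\<close>

  have "core_prevision f = (INF z\<in>{0..1}. lower_osc Z f z) +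
      integral {(INF z\<in>{0..1}. lower_osc Z f z)..(SUP z\<in>{0..1}. lower_osc Z f z)}
        (\<lambda>t. on_values core_prevision Z {z\<in>{0..1}. lower_osc Z f z \<ge> t})"
    unfolding core_prevision_class_inf[OF f, symmetric] on_values_def
  proof (rule core_prevision_choquet)
    show "level_family (\<lambda>v. lower_osc Z f (Z v)) (\<lambda>t. Z -` {z \<in> {0..1}. t \<le> lower_osc Z f z})"
      using Z_in by (auto simp: level_family_def)
    show "(INF z\<in>{0..1}. lower_osc Z f z) \<le> lower_osc Z f (Z v)"
      and "lower_osc Z f (Z v) \<le> (SUP z\<in>{0..1}. lower_osc Z f z)" for v
      by (intro cINF_lower cSUP_upper bdd f Z_in)+
  qed
  moreover
  let ?m = "INF z\<in>{0..1}. upper_osc Z f z" and ?M = "SUP z\<in>{0..1}. upper_osc Z f z"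
  define B where "B t = Z -` {z \<in> {0..1}. t \<le> upper_osc Z f z}" for t
  let ?\<psi> = "\<lambda>t. conjugate core_prevision (indicator (B t))"
  have "conjugate core_prevision f = ?m + integral {?m..?M} ?\<psi>"
  proof -
    have neg: "upper_osc Z f ` {0..1} = uminus ` lower_osc Z (\<lambda>x. - f x) ` {0..1}"
      by (simp add: lower_osc_uminus image_image)
    have bdd': "bdd_below (upper_osc Z f ` {0..1})" "bdd_above (upper_osc Z f ` {0..1})"
      unfolding neg using bdd[OF gamble_uminus[OF f]] by simp_all
    have bnd: "?m \<le> upper_osc Z f (Z v)" "upper_osc Z f (Z v) \<le> ?M" for v
      by (intro cINF_lower cSUP_upper bdd' Z_in)+
    have "?m \<le> ?M"
      using bnd[of one] by (rule order_trans)
    \<comment> \<open>complements of weak level sets: strict level sets of the negated function\<close>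
    have lev: "level_family (\<lambda>v. - upper_osc Z f (Z v)) (\<lambda>s. - B (- s))"
      using Z_in by (auto simp: level_family_def B_def)
    have "core_prevision (\<lambda>x. - f x)
        = - ?M + integral {- ?M..- ?m} (\<lambda>s. core_prevision (indicator (- B (- s))))"
      unfolding core_prevision_class_inf[OF gamble_uminus[OF f], symmetric] lower_osc_uminus
      by (rule core_prevision_choquet[OF lev]) (use bnd in auto)
    also have "\<dots> = - ?M + integral {?m..?M} (\<lambda>t. 1 - ?\<psi> t)"
      using Henstock_Kurzweil_Integration.integral_reflect_real[of ?M ?m "\<lambda>t. 1 - ?\<psi> t"] by (simp add: C.event_compl)
    also have "integral {?m..?M} (\<lambda>t. 1 - ?\<psi> t) = (?M - ?m) - integral {?m..?M} ?\<psi>"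
    proof -
      have "?\<psi> = (\<lambda>t. 1 - core_prevision (indicator (- B t)))"
        by (simp add: C.event_compl)
      moreover have "antimono (\<lambda>t. 1 - core_prevision (indicator (- B t)))"
        by (intro antimonoI diff_left_mono C.event_mono) (auto simp: B_def)
      ultimately have "?\<psi> integrable_on {?m..?M}"
        by (simp add: antimono_integrable_on)
      then show ?thesis
        using \<open>?m \<le> ?M\<close>
        by (subst Henstock_Kurzweil_Integration.integral_diff) (auto simp: integrable_const_ivl)
    qed
    finally show ?thesis
      by (simp add: conjugate_def)
  qed
  ultimately show ?thesis
    by (simp add: E conj_E f gamble_indicator on_values_def B_def)
qed

end
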